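(* Let $\mathcal A$ be an ordered domain algebra and let $\Gamma_D[\mathcal A]$ be its completion by $\Gamma_D$-closed up-sets, ordered by $C\leq D\iff C\supseteq D$. Then axioms (D1), (D3), (D4), (D5) and (D7) hold in $\Gamma_D[\mathcal A]$, i.e. for all $C,D\in\Gamma_D[\mathcal A]$: (D1) $\mathbf{dom}_\gamma(C)=(\mathbf{dom}_\gamma(C))^{\smile_\gamma}\leq \mathbf{id}_\gamma=\mathbf{dom}_\gamma(\mathbf{id}_\gamma)$; (D3) $\mathbf{dom}_\gamma(C^{\smile_\gamma})=\mathbf{ran}_\gamma(C)$; (D4) $\mathbf{dom}_\gamma(\mathbf{dom}_\gamma(C))=\mathbf{dom}_\gamma(C)=\mathbf{ran}_\gamma(\mathbf{dom}_\gamma(C))$; (D5) $\mathbf{dom}_\gamma(C);_\gamma C=C$; (D7) $\mathbf{dom}_\gamma(\mathbf{dom}_\gamma(C);_\gamma\mathbf{dom}_\gamma(D))=\mathbf{dom}_\gamma(C);_\gamma\mathbf{dom}_\gamma(D)=\mathbf{dom}_\gamma(D);_\gamma\mathbf{dom}_\gamma(C)$.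
   Context: An ordered domain algebra (ODA) is a structure $\mathcal A=(A,;,\mathbf{dom},\mathbf{ran},{}^\smile,0,\mathbf{id},\leq)$ such that: $\leq$ is a partial order with least element $0$; the operations ${}^\smile,;,\mathbf{dom},\mathbf{ran}$ are isotone and normal ($0^\smile=0;a=a;0=\mathbf{dom}(0)=\mathbf{ran}(0)=0$); $;$ is associative with two-sided identity $\mathbf{id}$, $\mathbf{id}^\smile=\mathbf{id}$, $(a^\smile)^\smile=a$, $(a;b)^\smile=b^\smile;a^\smile$; and (D1) $\mathbf{dom}(a)=(\mathbf{dom}(a))^\smile\leq\mathbf{id}=\mathbf{dom}(\mathbf{id})$; (D2) $\mathbf{dom}(a)\leq a;a^\smile$; (D3) $\mathbf{dom}(a^\smile)=\mathbf{ran}(a)$; (D4) $\mathbf{dom}(\mathbf{dom}(a))=\mathbf{dom}(a)=\mathbf{ran}(\mathbf{dom}(a))$; (D5) $\mathbf{dom}(a);a=a$; (D6) $\mathbf{dom}(a;b)=\mathbf{dom}(a;\mathbf{dom}(b))$; (D7) $\mathbf{dom}(\mathbf{dom}(a);\mathbf{dom}(b))=\mathbf{dom}(a);\mathbf{dom}(b)=\mathbf{dom}(b);\mathbf{dom}(a)$. For $S\subseteq A$ put $S^\uparrow=\{p\in A:\exists s\in S,\ s\leq p\}$. Up-sets of $A$ include $\emptyset$. An up-set $X$ of $A$ is $\Gamma_D$-closed if $\{\mathbf{dom}(x);y;\mathbf{ran}(z):x,y,z\in X\}^\uparrow=X$, and for an up-set $X$, $\Gamma_D(X)$ is the smallest $\Gamma_D$-closed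 up-set containing $X$. $\Gamma_D[\mathcal A]$ is the set of $\Gamma_D$-closed up-sets ordered by reverse inclusion, with operations $C;_\gamma D=\Gamma_D(\{c;d:c\in C,d\in D\}^\uparrow)$, $\mathbf{dom}_\gamma(C)=\Gamma_D(\{\mathbf{dom}(c):c\in C\}^\uparrow)$, $\mathbf{ran}_\gamma(C)=\Gamma_D(\{\mathbf{ran}(c):c\in C\}^\uparrow)$, $C^{\smile_\gamma}=\Gamma_D(\{c^\smile:c\in C\}^\uparrow)$, $0_\gamma=\{0\}^\uparrow$, $\mathbf{id}_\gamma=\{\mathbf{id}\}^\uparrow$.
   Formalization: The inequality in (D1), that the domain of C lies below the identity, is claimed only for nonempty C: the empty up-set is closed and is its own domain, but it does not contain the up-set of the identity, so the inequality fails there. *)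

theory Defs
  imports Main "HOL.Hull"
begin

section \<open>Ordered domain algebras\<close>

record 'a oda =
  carrier :: "'a set"
  Comp :: "'a \<Rightarrow> 'a \<Rightarrow> 'a" (infixl \<open>\<Zcomp>\<index>\<close> 70)
  Dom :: "'a \<Rightarrow> 'a"
  Ran :: "'a \<Rightarrow> 'a"
  Conv :: "'a \<Rightarrow> 'a"
  Zero :: 'a
  Ident :: 'a
  Le :: "'a \<Rightarrow> 'a \<Rightarrow> bool" (infix \<open>\<preceq>\<index>\<close> 50)

locale ordered_domain_algebra =
  fixes A :: "'a oda" (structure)
  assumes Comp_closed: "\<lbrakk>a \<in> carrier A; b \<in> carrier A\<rbrakk> \<Longrightarrow> a \<Zcomp> b \<in> carrier A"
    and Dom_closed: "a \<in> carrier A \<Longrightarrow> Dom A a \<in> carrier A"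
    and Ran_closed: "a \<in> carrier A \<Longrightarrow> Ran A a \<in> carrier A"
    and Conv_closed: "a \<in> carrier A \<Longrightarrow> Conv A a \<in> carrier A"
    and Zero_closed: "Zero A \<in> carrier A"
    and Ident_closed: "Ident A \<in> carrier A"
    and le_refl: "a \<in> carrier A \<Longrightarrow> a \<preceq> a"
    and le_trans: "\<lbrakk>a \<in> carrier A; b \<in> carrier A; c \<in> carrier A; a \<preceq> b; b \<preceq> c\<rbrakk> \<Longrightarrow> a \<preceq> c"
    and le_antisym: "\<lbrakk>a \<in> carrier A; b \<in> carrier A; a \<preceq> b; b \<preceq> a\<rbrakk> \<Longrightarrow> a = b"
    and Zero_least: "a \<in> carrier A \<Longrightarrow> Zero A \<preceq> a"
    and Conv_mono: "\<lbrakk>a \<in> carrier A; b \<in> carrier A; a \<preceq> b\<rbrakk> \<Longrightarrow> Conv A a \<preceq> Conv A b"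
    and Dom_mono: "\<lbrakk>a \<in> carrier A; b \<in> carrier A; a \<preceq> b\<rbrakk> \<Longrightarrow> Dom A a \<preceq> Dom A b"
    and Ran_mono: "\<lbrakk>a \<in> carrier A; b \<in> carrier A; a \<preceq> b\<rbrakk> \<Longrightarrow> Ran A a \<preceq> Ran A b"
    and Comp_mono: "\<lbrakk>a \<in> carrier A; b \<in> carrier A; c \<in> carrier A; d \<in> carrier A; a \<preceq> b; c \<preceq> d\<rbrakk>
          \<Longrightarrow> a \<Zcomp> c \<preceq> b \<Zcomp> d"
    and Conv_Zero: "Conv A (Zero A) = Zero A"
    and Zero_Comp: "a \<in> carrier A \<Longrightarrow> Zero A \<Zcomp> a = Zero A"
    and Comp_Zero: "a \<in> carrier A \<Longrightarrow> a \<Zcomp> Zero A = Zero A"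
    and Dom_Zero: "Dom A (Zero A) = Zero A"
    and Ran_Zero: "Ran A (Zero A) = Zero A"
    and Comp_assoc: "\<lbrakk>a \<in> carrier A; b \<in> carrier A; c \<in> carrier A\<rbrakk>
          \<Longrightarrow> (a \<Zcomp> b) \<Zcomp> c = a \<Zcomp> (b \<Zcomp> c)"
    and Ident_Comp: "a \<in> carrier A \<Longrightarrow> Ident A \<Zcomp> a = a"
    and Comp_Ident: "a \<in> carrier A \<Longrightarrow> a \<Zcomp> Ident A = a"
    and Conv_Ident: "Conv A (Ident A) = Ident A"
    and Conv_Conv: "a \<in> carrier A \<Longrightarrow> Conv A (Conv A a) = a"
    and Conv_Comp: "\<lbrakk>a \<in> carrier A; b \<in> carrier A\<rbrakk>
          \<Longrightarrow> Conv A (a \<Zcomp> b) = Conv A b \<Zcomp> Conv A a"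
    and D1: "a \<in> carrier A \<Longrightarrow> Dom A a = Conv A (Dom A a)"
            "a \<in> carrier A \<Longrightarrow> Dom A a \<preceq> Ident A"
            "Ident A = Dom A (Ident A)"
    and D2: "a \<in> carrier A \<Longrightarrow> Dom A a \<preceq> a \<Zcomp> Conv A a"
    and D3: "a \<in> carrier A \<Longrightarrow> Dom A (Conv A a) = Ran A a"
    and D4: "a \<in> carrier A \<Longrightarrow> Dom A (Dom A a) = Dom A a"
            "a \<in> carrier A \<Longrightarrow> Dom A a = Ran A (Dom A a)"
    and D5: "a \<in> carrier A \<Longrightarrow> Dom A a \<Zcomp> a = a"
    and D6: "\<lbrakk>a \<in> carrier A; b \<in> carrier A\<rbrakk> \<Longrightarrow> Dom A (a \<Zcomp> b) = Dom A (a \<Zcomp> Dom A b)"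
    and D7: "\<lbrakk>a \<in> carrier A; b \<in> carrier A\<rbrakk>
              \<Longrightarrow> Dom A (Dom A a \<Zcomp> Dom A b) = Dom A a \<Zcomp> Dom A b"
            "\<lbrakk>a \<in> carrier A; b \<in> carrier A\<rbrakk>
              \<Longrightarrow> Dom A a \<Zcomp> Dom A b = Dom A b \<Zcomp> Dom A a"


section \<open>The completion by closed up-sets\<close>

definition up :: "'a oda \<Rightarrow> 'a set \<Rightarrow> 'a set" where
  "up A S = {p \<in> carrier A. \<exists>s\<in>S. s \<preceq>\<^bsub>A\<^esub> p}"

definition upset :: "'a oda \<Rightarrow> 'a set \<Rightarrow> bool" where
  "upset A X \<longleftrightarrow> X \<subseteq> carrier A \<and> (\<forall>x\<in>X. \<forall>p\<in>carrier A. x \<preceq>\<^bsub>A\<^esub> p \<longrightarrow> p \<in> X)"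

definition gamma_closed :: "'a oda \<Rightarrow> 'a set \<Rightarrow> bool" where
  "gamma_closed A X \<longleftrightarrow> upset A X \<and>
     up A {Dom A x \<Zcomp>\<^bsub>A\<^esub> y \<Zcomp>\<^bsub>A\<^esub> Ran A z | x y z. x \<in> X \<and> y \<in> X \<and> z \<in> X} = X"

text \<open>The intersection of all closed up-sets containing \<open>X\<close>; that it is itself closed, hence the
  smallest such up-set, is shown in \<open>gamma_is_least\<close> below.\<close>

definition gamma :: "'a oda \<Rightarrow> 'a set \<Rightarrow> 'a set" where
  "gamma A X = gamma_closed A hull X"

definition gamma_completion :: "'a oda \<Rightarrow> 'a set oda" (\<open>\<Gamma>[_]\<close>) where
  "\<Gamma>[A] = \<lparr> carrier = {C. gamma_closed A C},
     Comp = (\<lambda>C D. gamma A (up A {c \<Zcomp>\<^bsub>A\<^esub> d | c d. c \<in> C \<and> d \<in> D})),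
     Dom = (\<lambda>C. gamma A (up A {Dom A c | c. c \<in> C})),
     Ran = (\<lambda>C. gamma A (up A {Ran A c | c. c \<in> C})),
     Conv = (\<lambda>C. gamma A (up A {Conv A c | c. c \<in> C})),
     Zero = up A {Zero A},
     Ident = up A {Ident A},
     Le = (\<lambda>C D. C \<supseteq> D) \<rparr>"

context ordered_domain_algebra
begin

lemma Ran_le_Ident: "a \<in> carrier A \<Longrightarrow> Ran A a \<preceq> Ident A"
  using D1(2)[of "Conv A a"] D3[of a] Conv_closed by auto

lemma triple_le:
  assumes "x \<in> carrier A" "y \<in> carrier A" "z \<in> carrier A"
  shows "Dom A x \<Zcomp> y \<Zcomp> Ran A z \<preceq> y"
proof -
  have "Dom A x \<Zcomp> y \<preceq> Ident A \<Zcomp> y"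
    using assms by (intro Comp_mono) (auto intro: Dom_closed Ident_closed D1 le_refl)
  then have "Dom A x \<Zcomp> y \<Zcomp> Ran A z \<preceq> (Ident A \<Zcomp> y) \<Zcomp> Ident A"
    using assms
    by (intro Comp_mono[of "Dom A x \<Zcomp> y" "Ident A \<Zcomp> y"])
      (auto intro: Dom_closed Ran_closed Comp_closed Ident_closed Ran_le_Ident)
  then show ?thesis
    using assms by (simp add: Ident_Comp Comp_Ident)
qed

lemma gamma_closed_iff:
  "gamma_closed A X \<longleftrightarrow>
     upset A X \<and> (\<forall>x\<in>X. \<forall>y\<in>X. \<forall>z\<in>X. Dom A x \<Zcomp> y \<Zcomp> Ran A z \<in> X)"
proof (cases "upset A X")
  case True
  let ?T = "{Dom A x \<Zcomp> y \<Zcomp> Ran A z | x y z. x \<in> X \<and> y \<in> X \<and> z \<in> X}"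
  have XA: "\<And>x. x \<in> X \<Longrightarrow> x \<in> carrier A"
    and Xup: "\<And>x p. \<lbrakk>x \<in> X; p \<in> carrier A; x \<preceq> p\<rbrakk> \<Longrightarrow> p \<in> X"
    using True by (auto simp: upset_def)
  have "X \<subseteq> up A ?T"
  proof
    fix x assume x: "x \<in> X"
    then have "Dom A x \<Zcomp> x \<Zcomp> Ran A x \<in> ?T" by blast
    then show "x \<in> up A ?T"
      using x XA triple_le[of x x x] unfolding up_def by blast
  qed
  moreover have "up A ?T \<subseteq> X \<longleftrightarrow> (\<forall>x\<in>X. \<forall>y\<in>X. \<forall>z\<in>X. Dom A x \<Zcomp> y \<Zcomp> Ran A z \<in> X)"
  proof
    assume sub: "up A ?T \<subseteq> X"
    show "\<forall>x\<in>X. \<forall>y\<in>X. \<forall>z\<in>X. Dom A x \<Zcomp> y \<Zcomp> Ran A z \<in> X"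
    proof (intro ballI)
      fix x y z assume xyz: "x \<in> X" "y \<in> X" "z \<in> X"
      then have c: "Dom A x \<Zcomp> y \<Zcomp> Ran A z \<in> carrier A"
        by (intro Comp_closed Dom_closed Ran_closed XA)
      have "Dom A x \<Zcomp> y \<Zcomp> Ran A z \<in> ?T" using xyz by blast
      then have "Dom A x \<Zcomp> y \<Zcomp> Ran A z \<in> up A ?T"
        using c le_refl[OF c] unfolding up_def by blast
      then show "Dom A x \<Zcomp> y \<Zcomp> Ran A z \<in> X" using sub by blast
    qed
  next
    assume h: "\<forall>x\<in>X. \<forall>y\<in>X. \<forall>z\<in>X. Dom A x \<Zcomp> y \<Zcomp> Ran A z \<in> X"
    show "up A ?T \<subseteq> X"
    proof
      fix p assume "p \<in> up A ?T"
      then obtain x y z where p: "p \<in> carrier A" "x \<in> X" "y \<in> X" "z \<in> X"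
          "Dom A x \<Zcomp> y \<Zcomp> Ran A z \<preceq> p"
        unfolding up_def by blast
      with h Xup show "p \<in> X" by blast
    qed
  qed
  ultimately show ?thesis
    using True unfolding gamma_closed_def by blast
qed (simp add: gamma_closed_def)

lemma gamma_closed_carrier: "gamma_closed A (carrier A)"
  by (auto simp: gamma_closed_iff upset_def intro: Comp_closed Dom_closed Ran_closed)

lemma gamma_is_least:
  assumes "upset A X"
  shows "gamma_closed A (gamma A X)" and "X \<subseteq> gamma A X"
    and "\<And>Y. \<lbrakk>gamma_closed A Y; X \<subseteq> Y\<rbrakk> \<Longrightarrow> gamma A X \<subseteq> Y"
proof -
  have "X \<subseteq> carrier A" using assms by (simp add: upset_def)
  then have sub: "gamma A X \<subseteq> carrier A"
    unfolding gamma_def by (rule hull_minimal) (rule gamma_closed_carrier)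
  have mem: "x \<in> gamma A X \<longleftrightarrow> (\<forall>Y. gamma_closed A Y \<and> X \<subseteq> Y \<longrightarrow> x \<in> Y)" for x
    by (auto simp: gamma_def hull_def)
  have "upset A (gamma A X)"
    unfolding upset_def
  proof (intro conjI sub ballI impI)
    fix x p assume "x \<in> gamma A X" "p \<in> carrier A" "x \<preceq> p"
    then show "p \<in> gamma A X" unfolding mem gamma_closed_iff upset_def by blast
  qed
  moreover have "\<forall>x\<in>gamma A X. \<forall>y\<in>gamma A X. \<forall>z\<in>gamma A X.
      Dom A x \<Zcomp> y \<Zcomp> Ran A z \<in> gamma A X"
    by (simp add: mem gamma_closed_iff)
  ultimately show "gamma_closed A (gamma A X)"
    by (simp add: gamma_closed_iff)
  show "X \<subseteq> gamma A X" unfolding gamma_def by (rule hull_subset)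
  show "\<And>Y. \<lbrakk>gamma_closed A Y; X \<subseteq> Y\<rbrakk> \<Longrightarrow> gamma A X \<subseteq> Y"
    unfolding gamma_def by (rule hull_minimal)
qed

text \<open>The empty up-set is an element of the completion, namely its greatest one, and it is its own
  domain. So \<open>Dom \<Gamma>[A] C \<preceq>\<^bsub>\<Gamma>[A]\<^esub> Ident \<Gamma>[A]\<close> always fails at \<open>C = {}\<close>.\<close>

lemma empty_counterexample:
  "{} \<in> carrier \<Gamma>[A]" "Dom \<Gamma>[A] {} = {}" "\<not> Dom \<Gamma>[A] {} \<preceq>\<^bsub>\<Gamma>[A]\<^esub> Ident \<Gamma>[A]"
proof -
  have closed: "gamma_closed A {}"
    by (simp add: gamma_closed_iff upset_def)
  then show "{} \<in> carrier \<Gamma>[A]"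
    by (simp add: gamma_completion_def)
  show dom: "Dom \<Gamma>[A] {} = {}"
    using closed by (simp add: gamma_completion_def gamma_def up_def hull_same)
  have "Ident A \<in> Ident \<Gamma>[A]"
    using Ident_closed le_refl by (simp add: gamma_completion_def up_def)
  then show "\<not> Dom \<Gamma>[A] {} \<preceq>\<^bsub>\<Gamma>[A]\<^esub> Ident \<Gamma>[A]"
    unfolding dom by (auto simp: gamma_completion_def)
qed

end

end

theory Submission
  imports Defs
begin

text \<open>Call a fixed point of \<open>Dom\<close> a test. By (D1), (D4), (D5) and (D7), the tests form a meet
  semilattice below the identity, with composition as meet, on which converse and \<open>Ran\<close> act
  trivially. For a set \<open>E\<close> of tests that is closed under composition, \<open>Dom x \<Zcomp> y \<Zcomp> Ran z\<close> lies
  above a product of three elements of \<open>E\<close> as soon as \<open>x\<close>, \<open>y\<close> and \<open>z\<close> lie above elements of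
  \<open>E\<close>. Hence the up-set generated by \<open>E\<close> is already closed
  (\<open>gamma_closed_up_test_semilattice\<close>), and no iteration of the closure is needed.

  The domains of the elements of a closed up-set \<open>C\<close> form such a set, because
  \<open>Dom c \<Zcomp> Dom d = Dom (Dom c \<Zcomp> d)\<close> and \<open>Dom c \<Zcomp> d\<close> is again in \<open>C\<close>
  (\<open>test_semilattice_Dom\<close>). So the domain of \<open>C\<close> in the completion is simply the up-set generated
  by the domains of the elements of \<open>C\<close>, and (D1), (D4) and (D7) reduce to the corresponding
  identities between tests. For (D3), closed up-sets are preserved by elementwise converse, which
  turns domains into ranges. For (D5), closedness of \<open>C\<close> says that multiplying by domains of
  elements of \<open>C\<close> does not lead out of \<open>C\<close>, and \<open>c = Dom c \<Zcomp> c\<close> recovers every element.\<close>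

section \<open>Up-sets and closure\<close>

context ordered_domain_algebra
begin

lemma upset_up: "S \<subseteq> carrier A \<Longrightarrow> upset A (up A S)"
  unfolding upset_def up_def by (blast intro: le_trans)

lemma up_upset: "upset A X \<Longrightarrow> up A X = X"
  unfolding upset_def up_def by (blast intro: le_refl)

lemma mem_upI: "\<lbrakk>p \<in> carrier A; s \<in> S; s \<preceq> p\<rbrakk> \<Longrightarrow> p \<in> up A S"
  by (auto simp: up_def)

lemma mem_upE:
  assumes "p \<in> up A S"
  obtains s where "p \<in> carrier A" "s \<in> S" "s \<preceq> p"
  using assms by (auto simp: up_def)

lemma up_subset: "S \<subseteq> T \<Longrightarrow> up A S \<subseteq> up A T"
  by (auto simp: up_def)

lemma subset_up: "S \<subseteq> carrier A \<Longrightarrow> S \<subseteq> up A S"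
  using le_refl by (blast intro: mem_upI)

lemma up_mono_image_up:
  assumes S: "S \<subseteq> carrier A"
    and closed: "\<And>a. a \<in> carrier A \<Longrightarrow> f a \<in> carrier A"
    and mono: "\<And>a b. \<lbrakk>a \<in> carrier A; b \<in> carrier A; a \<preceq> b\<rbrakk> \<Longrightarrow> f a \<preceq> f b"
  shows "up A {f x | x. x \<in> up A S} = up A {f x | x. x \<in> S}"
proof
  show "up A {f x | x. x \<in> up A S} \<subseteq> up A {f x | x. x \<in> S}"
  proof
    fix p assume "p \<in> up A {f x | x. x \<in> up A S}"
    then obtain s x where p: "p \<in> carrier A" "x \<in> carrier A" "f x \<preceq> p" "s \<in> S" "s \<preceq> x"
      by (auto elim!: mem_upE)
    moreover have s: "s \<in> carrier A" using p S by blast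
    ultimately have "f s \<preceq> p"
      using closed mono le_trans[of "f s" "f x" p] by blast
    with p show "p \<in> up A {f x | x. x \<in> S}" by (blast intro: mem_upI)
  qed
  show "up A {f x | x. x \<in> S} \<subseteq> up A {f x | x. x \<in> up A S}"
    using subset_up[OF S] by (intro up_subset) blast
qed

lemma up_Comp_up_up:
  assumes S: "S \<subseteq> carrier A" and T: "T \<subseteq> carrier A"
  shows "up A {x \<Zcomp> y | x y. x \<in> up A S \<and> y \<in> up A T} = up A {s \<Zcomp> t | s t. s \<in> S \<and> t \<in> T}"
proof
  show "up A {x \<Zcomp> y | x y. x \<in> up A S \<and> y \<in> up A T} \<subseteq> up A {s \<Zcomp> t | s t. s \<in> S \<and> t \<in> T}"
  proof
    fix p assume "p \<in> up A {x \<Zcomp> y | x y. x \<in> up A S \<and> y \<in> up A T}"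
    then obtain s t x y where p: "p \<in> carrier A" "x \<in> carrier A" "y \<in> carrier A"
        "x \<Zcomp> y \<preceq> p" "s \<in> S" "s \<preceq> x" "t \<in> T" "t \<preceq> y"
      by (auto elim!: mem_upE)
    moreover have st: "s \<in> carrier A" "t \<in> carrier A" using p S T by blast+
    ultimately have "s \<Zcomp> t \<preceq> p"
      using Comp_closed Comp_mono le_trans[of "s \<Zcomp> t" "x \<Zcomp> y" p] by blast
    with p show "p \<in> up A {s \<Zcomp> t | s t. s \<in> S \<and> t \<in> T}" by (blast intro: mem_upI)
  qed
  show "up A {s \<Zcomp> t | s t. s \<in> S \<and> t \<in> T} \<subseteq> up A {x \<Zcomp> y | x y. x \<in> up A S \<and> y \<in> up A T}"
    using subset_up[OF S] subset_up[OF T] by (intro up_subset) blast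
qed

lemma gamma_closed_upset: "gamma_closed A X \<Longrightarrow> upset A X"
  by (simp add: gamma_closed_def)

lemma gamma_closed_subset: "gamma_closed A X \<Longrightarrow> X \<subseteq> carrier A"
  by (simp add: gamma_closed_def upset_def)

lemma gamma_of_closed: "gamma_closed A X \<Longrightarrow> gamma A X = X"
  by (simp add: gamma_def hull_same)

text \<open>The closure condition multiplies on both sides at once. The factor on the right can be
  dropped because ranges lie below the identity and \<open>X\<close> is upward closed.\<close>

lemma gamma_closed_Dom_Comp:
  assumes "gamma_closed A X" "x \<in> X" "y \<in> X"
  shows "Dom A x \<Zcomp> y \<in> X"
proof -
  have car: "x \<in> carrier A" "y \<in> carrier A"
    using assms gamma_closed_subset by blast+
  then have dy: "Dom A x \<Zcomp> y \<in> carrier A"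
    by (simp add: Comp_closed Dom_closed)
  have "Dom A x \<Zcomp> y \<Zcomp> Ran A y \<in> X"
    using assms by (simp add: gamma_closed_iff)
  moreover have "Dom A x \<Zcomp> y \<Zcomp> Ran A y \<preceq> Dom A x \<Zcomp> y"
    using Comp_mono[of "Dom A x \<Zcomp> y" "Dom A x \<Zcomp> y" "Ran A y" "Ident A"] car dy
    by (simp add: Ran_closed Ident_closed le_refl Ran_le_Ident Comp_Ident)
  ultimately show ?thesis
    using assms(1) dy unfolding gamma_closed_iff upset_def by blast
qed

section \<open>Semilattices of tests\<close>

definition test_semilattice :: "'a set \<Rightarrow> bool" where
  "test_semilattice E \<longleftrightarrow> E \<subseteq> carrier A \<and> (\<forall>e\<in>E. Dom A e = e) \<and> (\<forall>e\<in>E. \<forall>f\<in>E. e \<Zcomp> f \<in> E)"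

lemma test_Comp:
  assumes "e \<in> carrier A" "f \<in> carrier A" "Dom A e = e" "Dom A f = f"
  shows "Dom A (e \<Zcomp> f) = e \<Zcomp> f" and "e \<Zcomp> f = f \<Zcomp> e"
  using D7[of e f] assms by simp_all

lemma test_Conv: "\<lbrakk>e \<in> carrier A; Dom A e = e\<rbrakk> \<Longrightarrow> Conv A e = e"
  using D1(1)[of e] by metis

lemma test_Ran: "\<lbrakk>e \<in> carrier A; Dom A e = e\<rbrakk> \<Longrightarrow> Ran A e = e"
  using D4(2)[of e] by metis

lemma test_semilattice_Ident: "test_semilattice {Ident A}"
  using D1(3)[symmetric] by (simp add: test_semilattice_def Ident_closed Ident_Comp)

text \<open>\<open>Dom\<close> and \<open>Ran\<close> are isotone and fix tests: if \<open>x\<close>, \<open>y\<close>, \<open>z\<close> lie above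
  tests \<open>e\<close>, \<open>f\<close>, \<open>g\<close> of \<open>E\<close>, then \<open>Dom x \<Zcomp> y \<Zcomp> Ran z\<close> lies above \<open>e \<Zcomp> f \<Zcomp> g\<close>.\<close>

lemma gamma_closed_up_test_semilattice:
  assumes "test_semilattice E"
  shows "gamma_closed A (up A E)"
proof -
  have E: "E \<subseteq> carrier A" and test: "\<And>e. e \<in> E \<Longrightarrow> Dom A e = e"
    and prod: "\<And>e f. \<lbrakk>e \<in> E; f \<in> E\<rbrakk> \<Longrightarrow> e \<Zcomp> f \<in> E"
    using assms by (auto simp: test_semilattice_def)
  have "Dom A x \<Zcomp> y \<Zcomp> Ran A z \<in> up A E"
    if xyz: "x \<in> up A E" "y \<in> up A E" "z \<in> up A E" for x y z
  proof -
    obtain e f g where x: "x \<in> carrier A" "e \<in> E" "e \<preceq> x"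
      and y: "y \<in> carrier A" "f \<in> E" "f \<preceq> y" and z: "z \<in> carrier A" "g \<in> E" "g \<preceq> z"
      using xyz by (auto elim!: mem_upE)
    have car: "e \<in> carrier A" "f \<in> carrier A" "g \<in> carrier A"
      using E x y z by blast+
    have "e \<preceq> Dom A x"
      using Dom_mono[of e x] x car test by simp
    moreover have "g \<preceq> Ran A z"
      using Ran_mono[of g z] z car test test_Ran by simp
    ultimately have "e \<Zcomp> f \<Zcomp> g \<preceq> Dom A x \<Zcomp> y \<Zcomp> Ran A z"
      using car x y z by (intro Comp_mono Comp_closed Dom_closed Ran_closed)
    moreover have "e \<Zcomp> f \<Zcomp> g \<in> E"
      using prod x y z by blast
    moreover have "Dom A x \<Zcomp> y \<Zcomp> Ran A z \<in> carrier A"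
      using x y z by (intro Comp_closed Dom_closed Ran_closed)
    ultimately show ?thesis by (blast intro: mem_upI)
  qed
  then show ?thesis
    using upset_up[OF E] by (simp add: gamma_closed_iff)
qed

text \<open>The product \<open>Dom c \<Zcomp> Dom d\<close> is the domain of \<open>Dom c \<Zcomp> d\<close> by (D6) and (D7), and closedness
  puts \<open>Dom c \<Zcomp> d\<close> in \<open>C\<close>.\<close>

lemma test_semilattice_Dom:
  assumes "gamma_closed A C"
  shows "test_semilattice {Dom A c | c. c \<in> C}"
proof -
  have C: "C \<subseteq> carrier A" using assms by (rule gamma_closed_subset)
  have "\<exists>b. Dom A c \<Zcomp> Dom A d = Dom A b \<and> b \<in> C" if "c \<in> C" "d \<in> C" for c d
  proof (intro exI conjI)
    show "Dom A c \<Zcomp> d \<in> C" using assms that by (rule gamma_closed_Dom_Comp)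
    have "c \<in> carrier A" "d \<in> carrier A" using that C by blast+
    then show "Dom A c \<Zcomp> Dom A d = Dom A (Dom A c \<Zcomp> d)"
      using D6[of "Dom A c" d] D7(1)[of c d] Dom_closed by simp
  qed
  then show ?thesis
    using C D4(1) Dom_closed unfolding test_semilattice_def by auto
qed

lemma test_semilattice_Comp:
  assumes "test_semilattice E" "test_semilattice F"
  shows "test_semilattice {e \<Zcomp> f | e f. e \<in> E \<and> f \<in> F}"
proof -
  have E: "\<And>e. e \<in> E \<Longrightarrow> e \<in> carrier A \<and> Dom A e = e"
    and F: "\<And>f. f \<in> F \<Longrightarrow> f \<in> carrier A \<and> Dom A f = f"
    using assms by (auto simp: test_semilattice_def)
  have "\<exists>e'' f''. (e \<Zcomp> f) \<Zcomp> (e' \<Zcomp> f') = e'' \<Zcomp> f'' \<and> e'' \<in> E \<and> f'' \<in> F"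
    if "e \<in> E" "f \<in> F" "e' \<in> E" "f' \<in> F" for e f e' f'
  proof (intro exI conjI)
    have car: "e \<in> carrier A" "f \<in> carrier A" "e' \<in> carrier A" "f' \<in> carrier A"
      using that E F by blast+
    have "(e \<Zcomp> f) \<Zcomp> (e' \<Zcomp> f') = e \<Zcomp> ((f \<Zcomp> e') \<Zcomp> f')"
      using car by (simp add: Comp_assoc Comp_closed)
    also have "f \<Zcomp> e' = e' \<Zcomp> f"
      using that E F by (intro test_Comp) blast+
    also have "e \<Zcomp> ((e' \<Zcomp> f) \<Zcomp> f') = (e \<Zcomp> e') \<Zcomp> (f \<Zcomp> f')"
      using car by (simp add: Comp_assoc Comp_closed)
    finally show "(e \<Zcomp> f) \<Zcomp> (e' \<Zcomp> f') = (e \<Zcomp> e') \<Zcomp> (f \<Zcomp> f')" .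
  qed (use that assms in \<open>auto simp: test_semilattice_def\<close>)
  moreover have "e \<Zcomp> f \<in> carrier A \<and> Dom A (e \<Zcomp> f) = e \<Zcomp> f" if "e \<in> E" "f \<in> F" for e f
    using that E F by (simp add: Comp_closed test_Comp(1))
  ultimately show ?thesis
    unfolding test_semilattice_def by auto
qed

section \<open>The operations of the completion\<close>

lemma Dom_completion:
  assumes "gamma_closed A C"
  shows "Dom \<Gamma>[A] C = up A {Dom A c | c. c \<in> C}"
  using gamma_of_closed[OF gamma_closed_up_test_semilattice[OF test_semilattice_Dom[OF assms]]]
  by (simp add: gamma_completion_def)

text \<open>An isotone operation, lifted to up-sets, is determined by its values on generators, and the
  three unary operations fix every generator that is a test.\<close>

lemma completion_up_test_semilattice:
  assumes "test_semilattice E"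
  shows "Dom \<Gamma>[A] (up A E) = up A E"
    and "Ran \<Gamma>[A] (up A E) = up A E"
    and "Conv \<Gamma>[A] (up A E) = up A E"
proof -
  have E: "E \<subseteq> carrier A" and test: "\<And>e. e \<in> E \<Longrightarrow> Dom A e = e"
    using assms by (auto simp: test_semilattice_def)
  have gamma: "gamma A (up A E) = up A E"
    using assms by (intro gamma_of_closed gamma_closed_up_test_semilattice)
  have fix_image: "{f e | e. e \<in> E} = E" if "\<And>e. e \<in> E \<Longrightarrow> f e = e" for f
    using that by force
  have "up A {Dom A x | x. x \<in> up A E} = up A {Dom A x | x. x \<in> E}"
    using E Dom_closed Dom_mono by (rule up_mono_image_up)
  also have "{Dom A x | x. x \<in> E} = E"
    using test by (rule fix_image)
  finally show "Dom \<Gamma>[A] (up A E) = up A E"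
    using gamma by (simp add: gamma_completion_def)
  have "up A {Ran A x | x. x \<in> up A E} = up A {Ran A x | x. x \<in> E}"
    using E Ran_closed Ran_mono by (rule up_mono_image_up)
  also have "{Ran A x | x. x \<in> E} = E"
    by (rule fix_image) (use E test test_Ran in blast)
  finally show "Ran \<Gamma>[A] (up A E) = up A E"
    using gamma by (simp add: gamma_completion_def)
  have "up A {Conv A x | x. x \<in> up A E} = up A {Conv A x | x. x \<in> E}"
    using E Conv_closed Conv_mono by (rule up_mono_image_up)
  also have "{Conv A x | x. x \<in> E} = E"
    by (rule fix_image) (use E test test_Conv in blast)
  finally show "Conv \<Gamma>[A] (up A E) = up A E"
    using gamma by (simp add: gamma_completion_def)
qed

lemma Comp_completion_up_test_semilattice:
  assumes "test_semilattice E" "test_semilattice F"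
  shows "up A E \<Zcomp>\<^bsub>\<Gamma>[A]\<^esub> up A F = up A {e \<Zcomp> f | e f. e \<in> E \<and> f \<in> F}"
proof -
  have "E \<subseteq> carrier A" "F \<subseteq> carrier A"
    using assms by (auto simp: test_semilattice_def)
  then have "up A {x \<Zcomp> y | x y. x \<in> up A E \<and> y \<in> up A F} = up A {e \<Zcomp> f | e f. e \<in> E \<and> f \<in> F}"
    by (rule up_Comp_up_up)
  moreover have "gamma A (up A {e \<Zcomp> f | e f. e \<in> E \<and> f \<in> F}) = up A {e \<Zcomp> f | e f. e \<in> E \<and> f \<in> F}"
    using assms by (intro gamma_of_closed gamma_closed_up_test_semilattice test_semilattice_Comp)
  ultimately show ?thesis
    by (simp add: gamma_completion_def)
qed

lemma Comp_test_semilattice_commute: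
  assumes "test_semilattice E" "test_semilattice F"
  shows "{e \<Zcomp> f | e f. e \<in> E \<and> f \<in> F} = {f \<Zcomp> e | f e. f \<in> F \<and> e \<in> E}"
proof -
  have "e \<Zcomp> f = f \<Zcomp> e" if "e \<in> E" "f \<in> F" for e f
    using that assms by (intro test_Comp(2)) (auto simp: test_semilattice_def)
  then show ?thesis by (intro Collect_cong) metis
qed

lemma Ran_Conv: "a \<in> carrier A \<Longrightarrow> Ran A (Conv A a) = Dom A a"
  using D3[of "Conv A a"] by (simp add: Conv_closed Conv_Conv)

text \<open>Converse is an isotone involution that reverses composition and exchanges domains with ranges,
  so it maps \<open>Dom x \<Zcomp> y \<Zcomp> Ran z\<close> to an expression of the same shape in the converses of \<open>z\<close>, \<open>y\<close>
  and \<open>x\<close>. No upward closure has to be taken.\<close>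

lemma gamma_closed_Conv:
  assumes "gamma_closed A C"
  shows "gamma_closed A {Conv A c | c. c \<in> C}"
proof -
  have C: "\<And>c. c \<in> C \<Longrightarrow> c \<in> carrier A"
    using gamma_closed_subset[OF assms] by blast
  have up: "\<And>c p. \<lbrakk>c \<in> C; p \<in> carrier A; c \<preceq> p\<rbrakk> \<Longrightarrow> p \<in> C"
    using gamma_closed_upset[OF assms] by (auto simp: upset_def)
  have mem: "p \<in> {Conv A c | c. c \<in> C} \<longleftrightarrow> p \<in> carrier A \<and> Conv A p \<in> C" for p
    using C Conv_closed Conv_Conv by force
  have "upset A {Conv A c | c. c \<in> C}"
    unfolding upset_def
  proof (intro conjI ballI impI subsetI)
    fix x p assume x: "x \<in> {Conv A c | c. c \<in> C}" and p: "p \<in> carrier A" "x \<preceq> p"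
    then have "Conv A x \<preceq> Conv A p" "Conv A x \<in> C"
      using Conv_mono by (simp_all only: mem)
    with p show "p \<in> {Conv A c | c. c \<in> C}"
      unfolding mem using up Conv_closed by blast
  qed (simp only: mem)
  moreover have "Dom A x \<Zcomp> y \<Zcomp> Ran A z \<in> {Conv A c | c. c \<in> C}"
    if xyz: "x \<in> {Conv A c | c. c \<in> C}" "y \<in> {Conv A c | c. c \<in> C}" "z \<in> {Conv A c | c. c \<in> C}"
    for x y z
  proof -
    have car: "x \<in> carrier A" "y \<in> carrier A" "z \<in> carrier A"
      and inC: "Conv A x \<in> C" "Conv A y \<in> C" "Conv A z \<in> C"
      using xyz by (simp_all only: mem)
    have "Conv A (Ran A z) = Ran A z"
      using D1(1)[of "Conv A z", symmetric] D3[of z] car Conv_closed by simp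
    moreover have "Conv A (Dom A x) = Dom A x"
      using D1(1)[of x, symmetric] car by simp
    ultimately have "Conv A (Dom A x \<Zcomp> y \<Zcomp> Ran A z) = Ran A z \<Zcomp> (Conv A y \<Zcomp> Dom A x)"
      using car by (simp add: Conv_Comp Comp_closed Dom_closed Ran_closed)
    also have "\<dots> = Dom A (Conv A z) \<Zcomp> Conv A y \<Zcomp> Ran A (Conv A x)"
      using car by (simp add: D3 Ran_Conv Comp_assoc Dom_closed Ran_closed Conv_closed)
    also have "\<dots> \<in> C"
      using assms inC by (simp add: gamma_closed_iff)
    finally show ?thesis
      unfolding mem using car by (simp add: Comp_closed Dom_closed Ran_closed)
  qed
  ultimately show ?thesis by (simp add: gamma_closed_iff)
qed

lemma Conv_completion:
  assumes "gamma_closed A C"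
  shows "Conv \<Gamma>[A] C = {Conv A c | c. c \<in> C}"
  using gamma_closed_Conv[OF assms]
  by (simp add: gamma_completion_def up_upset gamma_closed_upset gamma_of_closed)

section \<open>The axioms in the completion\<close>

text \<open>The order of the completion is reverse inclusion, so a witness \<open>Dom c\<close> below the identity is
  needed. The empty up-set, which is the greatest element and its own domain, has none.\<close>

lemma Dom_completion_le_Ident:
  assumes "gamma_closed A C" "C \<noteq> {}"
  shows "Dom \<Gamma>[A] C \<preceq>\<^bsub>\<Gamma>[A]\<^esub> Ident \<Gamma>[A]"
proof -
  obtain c where c: "c \<in> C" "c \<in> carrier A"
    using assms gamma_closed_subset by blast
  have "p \<in> up A {Dom A c | c. c \<in> C}" if "p \<in> carrier A" "Ident A \<preceq> p" for p
    using that c D1(2)[of c] le_trans[of "Dom A c" "Ident A" p] Dom_closed Ident_closed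
    by (intro mem_upI[of p "Dom A c"]) blast+
  then show ?thesis
    unfolding Dom_completion[OF assms(1)] by (auto simp: gamma_completion_def elim: mem_upE)
qed

lemma Dom_Conv_completion:
  assumes "gamma_closed A C"
  shows "Dom \<Gamma>[A] (Conv \<Gamma>[A] C) = Ran \<Gamma>[A] C"
proof -
  have "\<And>c. c \<in> C \<Longrightarrow> Dom A (Conv A c) = Ran A c"
    using D3 gamma_closed_subset[OF assms] by blast
  then have "{Dom A x | x. x \<in> {Conv A c | c. c \<in> C}} = {Ran A c | c. c \<in> C}"
    by force
  then show ?thesis
    unfolding Conv_completion[OF assms] by (simp add: gamma_completion_def)
qed

lemma Dom_Comp_completion:
  assumes "gamma_closed A C"
  shows "Dom \<Gamma>[A] C \<Zcomp>\<^bsub>\<Gamma>[A]\<^esub> C = C"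
proof -
  have C: "C \<subseteq> carrier A" using assms by (rule gamma_closed_subset)
  have upC: "up A C = C" using assms by (intro up_upset gamma_closed_upset)
  let ?E = "{Dom A c | c. c \<in> C}"
  have E: "?E \<subseteq> carrier A" using C Dom_closed by blast
  have "up A {x \<Zcomp> y | x y. x \<in> up A ?E \<and> y \<in> C} = up A {e \<Zcomp> c | e c. e \<in> ?E \<and> c \<in> C}"
    using up_Comp_up_up[OF E C] by (simp only: upC)
  also have "{e \<Zcomp> c | e c. e \<in> ?E \<and> c \<in> C} = C"
  proof
    show "{e \<Zcomp> c | e c. e \<in> ?E \<and> c \<in> C} \<subseteq> C"
      using gamma_closed_Dom_Comp[OF assms] by blast
    show "C \<subseteq> {e \<Zcomp> c | e c. e \<in> ?E \<and> c \<in> C}"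
    proof
      fix c assume c: "c \<in> C"
      then have "c = Dom A c \<Zcomp> c" using C D5[of c] by auto
      with c show "c \<in> {e \<Zcomp> c | e c. e \<in> ?E \<and> c \<in> C}" by blast
    qed
  qed
  finally show ?thesis
    unfolding Dom_completion[OF assms]
    using upC gamma_of_closed[OF assms] by (simp add: gamma_completion_def)
qed

end

theorem proposition7p7:
  fixes A :: "'a oda" and C D :: "'a set"
  assumes "ordered_domain_algebra A"
    and "C \<in> carrier \<Gamma>[A]" and "D \<in> carrier \<Gamma>[A]"
  shows
    "(Dom \<Gamma>[A] C = Conv \<Gamma>[A] (Dom \<Gamma>[A] C)
        \<and> (C \<noteq> {} \<longrightarrow> Conv \<Gamma>[A] (Dom \<Gamma>[A] C) \<preceq>\<^bsub>\<Gamma>[A]\<^esub> Ident \<Gamma>[A])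
        \<and> Ident \<Gamma>[A] = Dom \<Gamma>[A] (Ident \<Gamma>[A]))
     \<and> Dom \<Gamma>[A] (Conv \<Gamma>[A] C) = Ran \<Gamma>[A] C
     \<and> (Dom \<Gamma>[A] (Dom \<Gamma>[A] C) = Dom \<Gamma>[A] C
        \<and> Dom \<Gamma>[A] C = Ran \<Gamma>[A] (Dom \<Gamma>[A] C))
     \<and> Dom \<Gamma>[A] C \<Zcomp>\<^bsub>\<Gamma>[A]\<^esub> C = C
     \<and> (Dom \<Gamma>[A] (Dom \<Gamma>[A] C \<Zcomp>\<^bsub>\<Gamma>[A]\<^esub> Dom \<Gamma>[A] D)
          = Dom \<Gamma>[A] C \<Zcomp>\<^bsub>\<Gamma>[A]\<^esub> Dom \<Gamma>[A] D
        \<and> Dom \<Gamma>[A] C \<Zcomp>\<^bsub>\<Gamma>[A]\<^esub> Dom \<Gamma>[A] D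
          = Dom \<Gamma>[A] D \<Zcomp>\<^bsub>\<Gamma>[A]\<^esub> Dom \<Gamma>[A] C)"
proof -
  interpret ordered_domain_algebra A by (rule assms(1))
  have C: "gamma_closed A C" and D: "gamma_closed A D"
    using assms(2,3) by (simp_all add: gamma_completion_def)
  let ?E = "{Dom A c | c. c \<in> C}" and ?F = "{Dom A d | d. d \<in> D}"
  note E = test_semilattice_Dom[OF C] and F = test_semilattice_Dom[OF D]
  note domC = Dom_completion[OF C] and domD = Dom_completion[OF D]
  have Id: "Ident \<Gamma>[A] = up A {Ident A}"
    by (simp add: gamma_completion_def)
  have conv: "Conv \<Gamma>[A] (Dom \<Gamma>[A] C) = Dom \<Gamma>[A] C"
    unfolding domC by (rule completion_up_test_semilattice(3)[OF E])
  have d1: "C \<noteq> {} \<longrightarrow> Conv \<Gamma>[A] (Dom \<Gamma>[A] C) \<preceq>\<^bsub>\<Gamma>[A]\<^esub> Ident \<Gamma>[A]"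
    unfolding conv using Dom_completion_le_Ident[OF C] by blast
  have d1': "Dom \<Gamma>[A] (Ident \<Gamma>[A]) = Ident \<Gamma>[A]"
    unfolding Id by (rule completion_up_test_semilattice(1)[OF test_semilattice_Ident])
  have d4: "Dom \<Gamma>[A] (Dom \<Gamma>[A] C) = Dom \<Gamma>[A] C" "Ran \<Gamma>[A] (Dom \<Gamma>[A] C) = Dom \<Gamma>[A] C"
    unfolding domC by (rule completion_up_test_semilattice[OF E])+
  have d7: "Dom \<Gamma>[A] (Dom \<Gamma>[A] C \<Zcomp>\<^bsub>\<Gamma>[A]\<^esub> Dom \<Gamma>[A] D) = Dom \<Gamma>[A] C \<Zcomp>\<^bsub>\<Gamma>[A]\<^esub> Dom \<Gamma>[A] D"
    unfolding domC domD Comp_completion_up_test_semilattice[OF E F]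
    by (rule completion_up_test_semilattice(1)[OF test_semilattice_Comp[OF E F]])
  have d7': "Dom \<Gamma>[A] C \<Zcomp>\<^bsub>\<Gamma>[A]\<^esub> Dom \<Gamma>[A] D = Dom \<Gamma>[A] D \<Zcomp>\<^bsub>\<Gamma>[A]\<^esub> Dom \<Gamma>[A] C"
    unfolding domC domD Comp_completion_up_test_semilattice[OF E F]
      Comp_completion_up_test_semilattice[OF F E]
    by (subst Comp_test_semilattice_commute[OF E F]) (rule refl)
  show ?thesis
    using conv d1 d1' Dom_Conv_completion[OF C] d4 Dom_Comp_completion[OF C] d7 d7' by simp
qed

end
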